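(* Let $(\Phi,\mathfrak N,\mathfrak T,\mathfrak R,\mathfrak S,\phi_{\mathrm{start}},\Sigma,\mathrm{Lex},\mathrm{Sel})$ be a parameterized local lexing, $D\in\Sigma^*$, and $0\le k\le|D|$. Assume $\mathcal J_k^0\sim\mathcal J'^{\,0}_k$. Then $\mathcal J_k^u\sim\mathcal J'^{\,u}_k$ for all $u\ge0$, $\mathcal U(\mathcal T_k^u)=\mathcal T'^{\,u}_k$ for all $u\ge0$, and $\mathcal I_k\sim\mathcal I'_k$.
   Context: $\Phi$ is a non-empty set; $\mathfrak N,\mathfrak T$ disjoint sets of nonterminals and terminals; $\mathfrak S\in\mathfrak N$, $\phi_{\mathrm{start}}\in\Phi$; $\mathfrak R$ a set of parameterized rules $N_{f_{k+1}}\to X_1^{f_1}\cdots X_k^{f_k}$ ($k\ge0$, $N\in\mathfrak N$, $X_i\in\mathfrak N\cup\mathfrak T$, partial $f_i:\Phi^{2i-1}\rightharpoonup\Phi$); $\Sigma$ a set of characters; $\mathrm{Lex}$ assigns to each $(t,\alpha,D,k)$ ($t\in\mathfrak T,\alpha\in\Phi,0\le k\le|D|$) a set of parameterized tokens $(t,\alpha,\beta,c)\in\mathfrak T\times\Phi\times\Phi\times\Sigma^*$ with $k+|c|\le|D|$, $c_i=D_{k+i}$ for $0\le i<|c|$; $\mathrm{Sel}$ maps pairs $(A,B)$ of sets of parameterized tokens to a set with $A\subseteq\mathrm{Sel}(A,B)\subseteq B$ whenever $A\subseteq B$. Sequences indexed from 0; juxtaposition is concatenation; $\mathrm{take}_n$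 takes the first $n$ entries. $\langle f_1,\dots,f_u\rangle$ is the set of $\rho\in\Phi^{2u}$ with $f_i$ defined at $(\rho_0,\dots,\rho_{2i-2})$ and $\rho_{2i-1}=f_i(\rho_0,\dots,\rho_{2i-2})$ for $i=1,\dots,u$. Induced grammar: nonterminals $(\mathfrak N\times\Phi\times\Phi)\cup\{\top,\bot\}$, terminals $\overline{\mathfrak T}=\mathfrak T\times\Phi\times\Phi$, triples written $X^\alpha_\beta$, start $\top$; rules $\overline{\mathfrak R}=\{\top\to\mathfrak S^{\phi_{\mathrm{start}}}_\beta\mid\beta\in\Phi\}\cup\bigcup_{r\in\mathfrak R}\overline r$, where for $r=N_{f_{k+1}}\to X_1^{f_1}\cdots X_k^{f_k}$, $\overline r$ consists of (i) rules $N^\alpha_\beta\to(X_1)^{\alpha_1}_{\beta_1}\cdots(X_k)^{\alpha_k}_{\beta_k}$ with $(\alpha,\alpha_1,\beta_1,\dots,\alpha_k,\beta_k,\beta)\in\langle f_1,\dots,f_{k+1}\rangle$, and (ii) rules $N^\alpha_\beta\to(X_1)^{\alpha_1}_{\beta_1}\cdots(X_h)^{\alpha_h}_{\beta_h}\bot$ with $1\le h\le k$, $\beta,\beta_h\in\Phi$, $(\alpha,\alpha_1,\beta_1,\dots,\alpha_h)\in\langle f_1,\dots,f_h\rangle$ and $f_{h+1}$ undefined at $(\alpha,\alpha_1,\beta_1,\dots,\alpha_h,\beta_h)$. Induced lexer $\overline{\mathrm{Lex}}(t^\alpha_\beta)(D,k)=\{(t^\alpha_\beta,c)\mid(t,\alpha,\beta,c)\in\mathrm{Lex}(t,\alpha,D,k)\}$;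 $\mathcal U(t,\alpha,\beta,c)=(t^\alpha_\beta,c)$ lifted to sets; $\overline{\mathrm{Sel}}(A,B)=\mathcal U(\mathrm{Sel}(\mathcal U^{-1}A,\mathcal U^{-1}B))$. Items: parameterized item $(r,d,i,j,\rho)$ with $r=N_{f_{v+1}}\to X_1^{f_1}\cdots X_v^{f_v}\in\mathfrak R$, $0\le d\le v$, $0\le i\le j\le|D|$, $\rho\in\langle f_1,\dots,f_{d+1}\rangle$. Ordinary item $(q,d,i,j)$ with $q=(L\to w)\in\overline{\mathfrak R}$, $0\le d\le|w|$, $0\le i\le j\le|D|$, written $(L\to w_1\bullet w_2,i,j)$, $|w_1|=d$. For $x=(r,d,i,j,\rho)$, $\overline x$ consists of all $(q,d,i,j)$ with $q\in\overline r$ of type (i) and $\mathrm{take}_{2(d+1)}(\alpha,\alpha_1,\beta_1,\dots,\alpha_k,\beta_k,\beta)=\rho$, and all $(q,d,i,j)$ with $q\in\overline r$ of type (ii), $d\le h-1$, $\mathrm{take}_{2(d+1)}(\alpha,\alpha_1,\beta_1,\dots,\alpha_h)=\rho$. $\overline I=\bigcup_{x\in I}\overline x$; $\mathrm{Norm}(I')=\{(L\to w_1\bullet w_2,i,j)\in I'\mid L\ne\top,\ w_2\text{ is not the one-symbol string }\bot\}$; $I\sim I'$ means $\overline I=\mathrm{Norm}(I')$. PELLA steps ($r=N_{f_{v+1}}\to X_1^{f_1}\cdots X_v^{f_v}$): $\mathrm{Init}=\{(r,0,0,0,(\phi_{\mathrm{start}},f_1(\phi_{\mathrm{start}})))\mid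 r\text{ has left side }\mathfrak S,\ f_1\text{ defined at }\phi_{\mathrm{start}}\}$; $\mathrm{Predict}\,k\,I=I\cup\{(r',0,k,k,(\rho_{2d+1},g_1(\rho_{2d+1})))\mid(r,d,i,k,\rho)\in I,d<v,X_{d+1}=M,\ r'=M_{g_{u+1}}\to Y_1^{g_1}\cdots Y_u^{g_u}\in\mathfrak R,\ g_1\text{ defined at }\rho_{2d+1}\}$; $\mathrm{Complete}\,k\,I=I\cup\{(r,d+1,i,k,\rho'\,f_{d+2}(\rho'))\mid(r,d,i,j,\rho)\in I,d<v,X_{d+1}=M,\ (r',u,j,k,\xi)\in I\text{ with }r'=M_{g_{u+1}}\to Y_1^{g_1}\cdots Y_u^{g_u},\ \rho_{2d+1}=\xi_0,\ \rho'=\rho\,\xi_{2u+1},\ f_{d+2}\text{ defined at }\rho'\}$; $\mathrm{Tokens}\,T\,k\,I=\mathrm{Sel}(T,\{x\mid(r,d,i,k,\rho)\in I,d<v,X_{d+1}\in\mathfrak T,x\in\mathrm{Lex}(X_{d+1},\rho_{2d+1},D,k)\})$; $\mathrm{Scan}\,T\,k\,I=I\cup\{(r,d+1,i,k+|c|,\rho'\,f_{d+2}(\rho'))\mid(r,d,i,k,\rho)\in I,d<v,(X_{d+1},\rho_{2d+1},\beta,c)\in T,\rho'=\rho\,\beta,f_{d+2}\text{ defined at }\rho'\}$. ELLA steps: $\mathrm{Init}'=\{(\top\to\bullet w,0,0)\mid(\top\to w)\in\overline{\mathfrak R}\}$; $\mathrm{Predict}'\,k\,I'=I'\cup\{(M\to\bullet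 w,k,k)\mid(L\to a\bullet M\,b,i,k)\in I',(M\to w)\in\overline{\mathfrak R}\}$; $\mathrm{Complete}'\,k\,I'=I'\cup\{(L\to a\,M\bullet b,i,k)\mid(L\to a\bullet M\,b,i,j)\in I',(M\to w\bullet,j,k)\in I'\}$; $\mathrm{Tokens}'\,T'\,k\,I'=\overline{\mathrm{Sel}}(T',\{x\mid(L\to a\bullet t\,b,i,k)\in I',t\in\overline{\mathfrak T},x\in\overline{\mathrm{Lex}}(t)(D,k)\})$; $\mathrm{Scan}'\,T'\,k\,I'=I'\cup\{(L\to a\,t\bullet b,i,k+|c|)\mid(L\to a\bullet t\,b,i,k)\in I',(t,c)\in T'\}$. Equations (with $\mathrm{limit}\,f\,X=\bigcup_{n\ge0}f^n(X)$): $\pi_k\,T\,I=\mathrm{limit}(\mathrm{Scan}\,T\,k\circ\mathrm{Complete}\,k\circ\mathrm{Predict}\,k)\,I$; $\mathcal J_0^0=\pi_0\,\emptyset\,\mathrm{Init}$; $\mathcal T_k^0=\emptyset$; $\mathcal T_k^{u+1}=\mathrm{Tokens}\,\mathcal T_k^u\,k\,\mathcal J_k^u$; $\mathcal J_k^{u+1}=\pi_k\,\mathcal T_k^{u+1}\,\mathcal J_k^u$; $\mathcal I_k=\bigcup_{u\ge0}\mathcal J_k^u$; $\mathcal J_{k+1}^0=\pi_{k+1}\,\emptyset\,\mathcal I_k$. The primed objects $\pi'_k,\mathcal J'^{\,u}_k,\mathcal T'^{\,u}_k,\mathcal I'_k$ are defined by the same equations with $\mathrm{Init}',\mathrm{Predict}',\mathrm{Complete}',\mathrm{Tokens}',\mathrm{Scan}'$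 in place of the unprimed steps. *)

theory Defs
  imports Main
begin

type_synonym 'p pfun = "'p list \<rightharpoonup> 'p"

text \<open>The rule \<open>N_{f_{k+1}} \<rightarrow> X_1^{f_1} \<dots> X_k^{f_k}\<close> is
  \<open>PRule N [(X_1, f_1), \<dots>, (X_k, f_k)] f_{k+1}\<close>. All lists are indexed from 0, so that
  \<open>X_i\<close> is \<open>rsyms r ! (i - 1)\<close> and \<open>f_i\<close> is \<open>rfuns r ! (i - 1)\<close>.\<close>

datatype ('s, 'p) prule = PRule (lhs: 's) (body: "('s \<times> 'p pfun) list") (outfun: "'p pfun")

definition rsyms :: "('s, 'p) prule \<Rightarrow> 's list" where
  "rsyms r = map fst (body r)"

definition rfuns :: "('s, 'p) prule \<Rightarrow> 'p pfun list" where
  "rfuns r = map snd (body r) @ [outfun r]"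

abbreviation rlen :: "('s, 'p) prule \<Rightarrow> nat" where
  "rlen r \<equiv> length (body r)"

type_synonym ('s, 'p, 'c) ptoken = "'s \<times> 'p \<times> 'p \<times> 'c list"

record ('s, 'p, 'c) pll =
  Params :: "'p set"
  Nonterms :: "'s set"
  Terms :: "'s set"
  Rules :: "('s, 'p) prule set"
  Start :: 's
  phi_start :: 'p
  Chars :: "'c set"
  Lex :: "'s \<Rightarrow> 'p \<Rightarrow> 'c list \<Rightarrow> nat \<Rightarrow> ('s, 'p, 'c) ptoken set"
  Sel :: "('s, 'p, 'c) ptoken set \<Rightarrow> ('s, 'p, 'c) ptoken set \<Rightarrow> ('s, 'p, 'c) ptoken set"

definition ptokens :: "('s, 'p, 'c) pll \<Rightarrow> ('s, 'p, 'c) ptoken set" where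
  "ptokens L = Terms L \<times> Params L \<times> Params L \<times> lists (Chars L)"

definition partial_fun_on :: "'p set \<Rightarrow> nat \<Rightarrow> 'p pfun \<Rightarrow> bool" where
  "partial_fun_on P n f \<longleftrightarrow> dom f \<subseteq> {xs \<in> lists P. length xs = n} \<and> ran f \<subseteq> P"

locale parameterized_local_lexing =
  fixes L :: "('s, 'p, 'c) pll"
  assumes params_nonempty: "Params L \<noteq> {}"
    and symbols_disjoint: "Nonterms L \<inter> Terms L = {}"
    and start_nonterm: "Start L \<in> Nonterms L"
    and phi_start_param: "phi_start L \<in> Params L"
    and rule_lhs: "r \<in> Rules L \<Longrightarrow> lhs r \<in> Nonterms L"
    and rule_syms: "r \<in> Rules L \<Longrightarrow> set (rsyms r) \<subseteq> Nonterms L \<union> Terms L"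
    and rule_funs: "\<lbrakk>r \<in> Rules L; i \<le> rlen r\<rbrakk> \<Longrightarrow>
      partial_fun_on (Params L) (2 * i + 1) (rfuns r ! i)"
    and lex_tokens: "\<lbrakk>t \<in> Terms L; \<alpha> \<in> Params L; D \<in> lists (Chars L); k \<le> length D;
        x \<in> Lex L t \<alpha> D k\<rbrakk> \<Longrightarrow>
      \<exists>\<beta> c. x = (t, \<alpha>, \<beta>, c) \<and> x \<in> ptokens L \<and> k + length c \<le> length D \<and>
        (\<forall>i < length c. c ! i = D ! (k + i))"
    and sel_bounds: "\<lbrakk>A \<subseteq> B; B \<subseteq> ptokens L\<rbrakk> \<Longrightarrow> A \<subseteq> Sel L A B \<and> Sel L A B \<subseteq> B"

text \<open>\<open>chains P [f_1, \<dots>, f_u]\<close> is the set \<open>\<langle>f_1, \<dots>, f_u\<rangle>\<close> of parameter sequences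
  of length \<open>2u\<close>.\<close>

definition chains :: "'p set \<Rightarrow> 'p pfun list \<Rightarrow> 'p list set" where
  "chains P fs = {\<rho> \<in> lists P. length \<rho> = 2 * length fs \<and>
     (\<forall>i < length fs. (fs ! i) (take (2 * i + 1) \<rho>) = Some (\<rho> ! (2 * i + 1)))}"

text \<open>\<open>Sym X \<alpha> \<beta>\<close> is the triple \<open>X\<^sup>\<alpha>\<^sub>\<beta>\<close>; it is a nonterminal or a
  terminal of the induced grammar according to whether \<open>X\<close> is one.\<close>

datatype ('s, 'p) isym = Top | Bot | Sym 's 'p 'p

type_synonym ('s, 'p) irule = "('s, 'p) isym \<times> ('s, 'p) isym list"

type_synonym ('s, 'p, 'c) itoken = "('s, 'p) isym \<times> 'c list"

definition iterms :: "('s, 'p, 'c) pll \<Rightarrow> ('s, 'p) isym set" where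
  "iterms L = {Sym t \<alpha> \<beta> | t \<alpha> \<beta>. t \<in> Terms L \<and> \<alpha> \<in> Params L \<and> \<beta> \<in> Params L}"

text \<open>The parameter sequence is read as \<open>\<sigma> = (\<alpha>, \<alpha>_1, \<beta>_1, \<dots>, \<alpha>_n, \<beta>_n, \<dots>)\<close>, so
  \<open>\<alpha>_i\<close> is \<open>\<sigma> ! (2 * i - 1)\<close> and \<open>\<beta>_i\<close> is \<open>\<sigma> ! (2 * i)\<close>.\<close>

definition isyms :: "('s, 'p) prule \<Rightarrow> nat \<Rightarrow> 'p list \<Rightarrow> ('s, 'p) isym list" where
  "isyms r n \<sigma> = map (\<lambda>i. Sym (rsyms r ! i) (\<sigma> ! (2 * i + 1)) (\<sigma> ! (2 * i + 2))) [0..<n]"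

text \<open>Both kinds of induced rules are given together with the parameter sequence they
  arise from: \<open>(\<alpha>, \<alpha>_1, \<beta>_1, \<dots>, \<alpha>_k, \<beta>_k, \<beta>)\<close> for the complete rules, and
  \<open>(\<alpha>, \<alpha>_1, \<beta>_1, \<dots>, \<alpha>_h)\<close> together with the length \<open>h\<close> for the rules ending
  in \<open>Bot\<close>.\<close>

definition full_irules ::
    "('s, 'p, 'c) pll \<Rightarrow> ('s, 'p) prule \<Rightarrow> (('s, 'p) irule \<times> 'p list) set" where
  "full_irules L r =
     {((Sym (lhs r) (\<sigma> ! 0) (\<sigma> ! (2 * rlen r + 1)), isyms r (rlen r) \<sigma>), \<sigma>) | \<sigma>.
        \<sigma> \<in> chains (Params L) (rfuns r)}"

definition stuck_irules ::
    "('s, 'p, 'c) pll \<Rightarrow> ('s, 'p) prule \<Rightarrow> (('s, 'p) irule \<times> nat \<times> 'p list) set" where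
  "stuck_irules L r =
     {((Sym (lhs r) (\<sigma> ! 0) \<beta>, isyms r h (\<sigma> @ [\<beta>h]) @ [Bot]), h, \<sigma>) | h \<sigma> \<beta> \<beta>h.
        1 \<le> h \<and> h \<le> rlen r \<and> \<beta> \<in> Params L \<and> \<beta>h \<in> Params L \<and>
        \<sigma> \<in> chains (Params L) (take h (rfuns r)) \<and> (rfuns r ! h) (\<sigma> @ [\<beta>h]) = None}"

definition irules_of :: "('s, 'p, 'c) pll \<Rightarrow> ('s, 'p) prule \<Rightarrow> ('s, 'p) irule set" where
  "irules_of L r = fst ` full_irules L r \<union> fst ` stuck_irules L r"

definition irules :: "('s, 'p, 'c) pll \<Rightarrow> ('s, 'p) irule set" where
  "irules L = {(Top, [Sym (Start L) (phi_start L) \<beta>]) | \<beta>. \<beta> \<in> Params L} \<union>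
     (\<Union>r \<in> Rules L. irules_of L r)"

fun ilex :: "('s, 'p, 'c) pll \<Rightarrow> ('s, 'p) isym \<Rightarrow> 'c list \<Rightarrow> nat \<Rightarrow> ('s, 'p, 'c) itoken set" where
  "ilex L (Sym t \<alpha> \<beta>) D k = {(Sym t \<alpha> \<beta>, c) | c. (t, \<alpha>, \<beta>, c) \<in> Lex L t \<alpha> D k}"
| "ilex L Top D k = {}"
| "ilex L Bot D k = {}"

fun utok :: "('s, 'p, 'c) ptoken \<Rightarrow> ('s, 'p, 'c) itoken" where
  "utok (t, \<alpha>, \<beta>, c) = (Sym t \<alpha> \<beta>, c)"

definition isel :: "('s, 'p, 'c) pll \<Rightarrow>
    ('s, 'p, 'c) itoken set \<Rightarrow> ('s, 'p, 'c) itoken set \<Rightarrow> ('s, 'p, 'c) itoken set" where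
  "isel L A B = utok ` Sel L (utok -` A) (utok -` B)"

text \<open>Items are plain tuples. Their well-formedness conditions (the rule belongs to the
  grammar, the dot lies within the rule, \<open>i \<le> j \<le> |D|\<close>, \<open>\<rho>\<close> is a chain of length
  \<open>2(d + 1)\<close>) are not part of the types; up to position \<open>|D|\<close> the steps below produce only items satisfying
  them.\<close>

type_synonym ('s, 'p) pitem = "('s, 'p) prule \<times> nat \<times> nat \<times> nat \<times> 'p list"

type_synonym ('s, 'p) iitem = "('s, 'p) irule \<times> nat \<times> nat \<times> nat"

fun item_bar :: "('s, 'p, 'c) pll \<Rightarrow> ('s, 'p) pitem \<Rightarrow> ('s, 'p) iitem set" where
  "item_bar L (r, d, i, j, \<rho>) =
     {(q, d, i, j) | q \<sigma>. (q, \<sigma>) \<in> full_irules L r \<and> take (2 * (d + 1)) \<sigma> = \<rho>} \<union>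
     {(q, d, i, j) | q h \<sigma>. (q, h, \<sigma>) \<in> stuck_irules L r \<and> d < h \<and>
        take (2 * (d + 1)) \<sigma> = \<rho>}"

definition items_bar :: "('s, 'p, 'c) pll \<Rightarrow> ('s, 'p) pitem set \<Rightarrow> ('s, 'p) iitem set" where
  "items_bar L I = (\<Union>x \<in> I. item_bar L x)"

definition Norm :: "('s, 'p) iitem set \<Rightarrow> ('s, 'p) iitem set" where
  "Norm I' = {((l, w), d, i, j) | l w d i j.
     ((l, w), d, i, j) \<in> I' \<and> l \<noteq> Top \<and> drop d w \<noteq> [Bot]}"

definition items_sim ::
    "('s, 'p, 'c) pll \<Rightarrow> ('s, 'p) pitem set \<Rightarrow> ('s, 'p) iitem set \<Rightarrow> bool" where
  "items_sim L I I' \<longleftrightarrow> items_bar L I = Norm I'"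

text \<open>The parameterized and the ordinary algorithm solve the same equations for different
  steps; \<open>pella\<close> and \<open>ella\<close> below are the two instances, the latter for the induced
  local lexing.\<close>

record ('i, 't) steps =
  Init :: "'i set"
  Predict :: "nat \<Rightarrow> 'i set \<Rightarrow> 'i set"
  Complete :: "nat \<Rightarrow> 'i set \<Rightarrow> 'i set"
  Tokens :: "'t set \<Rightarrow> nat \<Rightarrow> 'i set \<Rightarrow> 't set"
  Scan :: "'t set \<Rightarrow> nat \<Rightarrow> 'i set \<Rightarrow> 'i set"

definition limit :: "('a set \<Rightarrow> 'a set) \<Rightarrow> 'a set \<Rightarrow> 'a set" where
  "limit f X = (\<Union>n. (f ^^ n) X)"

definition pi_step :: "('i, 't) steps \<Rightarrow> nat \<Rightarrow> 't set \<Rightarrow> 'i set \<Rightarrow> 'i set" where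
  "pi_step E k T = limit (Scan E T k \<circ> Complete E k \<circ> Predict E k)"

fun \<J> :: "('i, 't) steps \<Rightarrow> nat \<Rightarrow> nat \<Rightarrow> 'i set"
  and \<T> :: "('i, 't) steps \<Rightarrow> nat \<Rightarrow> nat \<Rightarrow> 't set" where
  "\<J> E 0 0 = pi_step E 0 {} (Init E)"
| "\<J> E (Suc k) 0 = pi_step E (Suc k) {} (\<Union>u. \<J> E k u)"
| "\<J> E k (Suc u) = pi_step E k (\<T> E k (Suc u)) (\<J> E k u)"
| "\<T> E k 0 = {}"
| "\<T> E k (Suc u) = Tokens E (\<T> E k u) k (\<J> E k u)"

definition \<I> :: "('i, 't) steps \<Rightarrow> nat \<Rightarrow> 'i set" where
  "\<I> E k = (\<Union>u. \<J> E k u)"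

definition pella :: "('s, 'p, 'c) pll \<Rightarrow> 'c list \<Rightarrow>
    (('s, 'p) pitem, ('s, 'p, 'c) ptoken) steps" where
  "pella L D = \<lparr>
     Init = {(r, 0, 0, 0, [phi_start L, y]) | r y.
       r \<in> Rules L \<and> lhs r = Start L \<and> (rfuns r ! 0) [phi_start L] = Some y},
     Predict = (\<lambda>k I. I \<union> {(r', 0, k, k, [\<rho> ! (2 * d + 1), y]) | r' y r d i \<rho>.
       (r, d, i, k, \<rho>) \<in> I \<and> d < rlen r \<and> r' \<in> Rules L \<and> lhs r' = rsyms r ! d \<and>
       (rfuns r' ! 0) [\<rho> ! (2 * d + 1)] = Some y}),
     Complete = (\<lambda>k I. I \<union> {(r, d + 1, i, k, \<rho>' @ [y]) | r d i j \<rho> r' \<xi> \<rho>' y.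
       (r, d, i, j, \<rho>) \<in> I \<and> d < rlen r \<and> lhs r' = rsyms r ! d \<and>
       (r', rlen r', j, k, \<xi>) \<in> I \<and> \<rho> ! (2 * d + 1) = \<xi> ! 0 \<and>
       \<rho>' = \<rho> @ [\<xi> ! (2 * rlen r' + 1)] \<and> (rfuns r ! (d + 1)) \<rho>' = Some y}),
     Tokens = (\<lambda>T k I. Sel L T {x | x r d i \<rho>.
       (r, d, i, k, \<rho>) \<in> I \<and> d < rlen r \<and> rsyms r ! d \<in> Terms L \<and>
       x \<in> Lex L (rsyms r ! d) (\<rho> ! (2 * d + 1)) D k}),
     Scan = (\<lambda>T k I. I \<union> {(r, d + 1, i, k + length c, \<rho>' @ [y]) | r d i \<rho> \<beta> c \<rho>' y.
       (r, d, i, k, \<rho>) \<in> I \<and> d < rlen r \<and> (rsyms r ! d, \<rho> ! (2 * d + 1), \<beta>, c) \<in> T \<and>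
       \<rho>' = \<rho> @ [\<beta>] \<and> (rfuns r ! (d + 1)) \<rho>' = Some y})\<rparr>"

definition ella :: "('s, 'p, 'c) pll \<Rightarrow> 'c list \<Rightarrow>
    (('s, 'p) iitem, ('s, 'p, 'c) itoken) steps" where
  "ella L D = \<lparr>
     Init = {((Top, w), 0, 0, 0) | w. (Top, w) \<in> irules L},
     Predict = (\<lambda>k I. I \<union> {((M, w), 0, k, k) | M w l v d i.
       ((l, v), d, i, k) \<in> I \<and> d < length v \<and> v ! d = M \<and> (M, w) \<in> irules L}),
     Complete = (\<lambda>k I. I \<union> {((l, v), d + 1, i, k) | l v d i j M w.
       ((l, v), d, i, j) \<in> I \<and> d < length v \<and> v ! d = M \<and>
       ((M, w), length w, j, k) \<in> I}),
     Tokens = (\<lambda>T k I. isel L T {x | x l v d i t.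
       ((l, v), d, i, k) \<in> I \<and> d < length v \<and> v ! d = t \<and> t \<in> iterms L \<and>
       x \<in> ilex L t D k}),
     Scan = (\<lambda>T k I. I \<union> {((l, v), d + 1, i, k + length c) | l v d i t c.
       ((l, v), d, i, k) \<in> I \<and> d < length v \<and> v ! d = t \<and> (t, c) \<in> T})\<rparr>"

end

theory Submission imports Defs begin

text \<open>Every single step preserves the simulation. An ordinary item kept by
  \<open>Norm\<close> lies in the image of a parameterized item, and advancing its dot over a symbol
  prescribes the parameter \<open>\<beta>\<close> returned by that symbol: either the next partial
  function is defined there and the parameterized item advances as well, or the rule is one
  that continues with \<open>Bot\<close> and \<open>Norm\<close> drops the result. Conversely every parameterized
  item is the image of some ordinary item with an arbitrarily prescribed next \<open>\<beta>\<close>,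
  because its parameter sequence can always be continued to a complete or a stuck rule. The items
  with left side \<open>Top\<close>, which \<open>Norm\<close> drops, predict only at position 0, and there their
  predictions already belong to the start set \<open>\<J> (ella L D) 0 0\<close>.\<close>

section \<open>Limits of step operators and growth of \<open>\<J>\<close> in its last index\<close>

lemma limit_least:
  assumes "X \<subseteq> W" and "\<And>Y. Y \<subseteq> W \<Longrightarrow> f Y \<subseteq> W"
  shows "limit f X \<subseteq> W"
proof -
  have "(f ^^ n) X \<subseteq> W" for n
    by (induction n) (use assms in auto)
  then show ?thesis
    unfolding limit_def by blast
qed

lemma iterate_subset_limit: "(f ^^ n) X \<subseteq> limit f X"
  unfolding limit_def by blast

lemma \<J>_Suc_right: "\<J> E k (Suc u) = pi_step E k (\<T> E k (Suc u)) (\<J> E k u)"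
  by (cases k) auto

lemma subset_pi_step: "X \<subseteq> pi_step E k T X"
  using iterate_subset_limit[of 0 _ X] by (simp add: pi_step_def)

lemma \<J>_subset_Suc: "\<J> E k u \<subseteq> \<J> E k (Suc u)"
  unfolding \<J>_Suc_right by (rule subset_pi_step)

lemma \<J>_0_subset: "\<J> E k 0 \<subseteq> \<J> E k u"
proof (induction u)
  case (Suc u)
  then show ?case
    using \<J>_subset_Suc by (rule subset_trans)
qed simp

section \<open>Parameter chains, induced symbols and tokens\<close>

lemma chains_length: "\<rho> \<in> chains P fs \<Longrightarrow> length \<rho> = 2 * length fs"
  by (simp add: chains_def)

lemma chains_nth:
  "\<rho> \<in> chains P fs \<Longrightarrow> i < length fs \<Longrightarrow> (fs ! i) (take (2 * i + 1) \<rho>) = Some (\<rho> ! (2 * i + 1))"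
  by (simp add: chains_def)

lemma chains_mem: "\<rho> \<in> chains P fs \<Longrightarrow> i < 2 * length fs \<Longrightarrow> \<rho> ! i \<in> P"
  by (auto simp: chains_def in_lists_conv_set)

lemma chains_append:
  assumes "\<rho> \<in> chains P fs" and "\<beta> \<in> P" and "y \<in> P" and "f (\<rho> @ [\<beta>]) = Some y"
  shows "\<rho> @ [\<beta>, y] \<in> chains P (fs @ [f])"
proof -
  have "((fs @ [f]) ! i) (take (2 * i + 1) (\<rho> @ [\<beta>, y])) = Some ((\<rho> @ [\<beta>, y]) ! (2 * i + 1))"
    if "i < Suc (length fs)" for i
  proof (cases "i = length fs")
    case True
    then show ?thesis
      using assms by (simp add: chains_def nth_append)
  next
    case False
    with that have "i < length fs" by simp
    then show ?thesis
      using assms(1) by (simp add: chains_def nth_append)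
  qed
  then show ?thesis
    using assms by (simp add: chains_def)
qed

lemma length_rfuns [simp]: "length (rfuns r) = Suc (rlen r)"
  by (simp add: rfuns_def)

lemma length_rsyms [simp]: "length (rsyms r) = rlen r"
  by (simp add: rsyms_def)

lemma length_isyms [simp]: "length (isyms r n \<sigma>) = n"
  by (simp add: isyms_def)

lemma isyms_nth [simp]:
  "i < n \<Longrightarrow> isyms r n \<sigma> ! i = Sym (rsyms r ! i) (\<sigma> ! (2 * i + 1)) (\<sigma> ! (2 * i + 2))"
  by (simp add: isyms_def)

lemma Bot_notin_isyms [simp]: "Bot \<notin> set (isyms r n \<sigma>)" "Top \<notin> set (isyms r n \<sigma>)"
  by (auto simp: isyms_def)

lemma inj_utok: "inj utok"
  by (auto simp: inj_def)

text \<open>Injectivity of \<open>utok\<close> makes the preimages taken in \<open>isel\<close> give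
  back \<open>A\<close> and \<open>B\<close>.\<close>

lemma isel_utok: "isel L (utok ` A) (utok ` B) = utok ` Sel L A B"
  by (simp add: isel_def inj_vimage_image_eq inj_utok)

section \<open>Rules covered by a parameter prefix, and the similarity relation\<close>

text \<open>This is \<open>item_bar\<close> with the positions stripped off: these agree on both
  sides, so what remains relates an induced rule to the parameters read up to the dot. In a rule
  ending in \<open>Bot\<close> the sequence has length \<open>2 * h\<close>, so \<open>d < h\<close>
  says that the prefix still fits into it.\<close>

definition covers ::
    "('s, 'p, 'c) pll \<Rightarrow> ('s, 'p) irule \<Rightarrow> ('s, 'p) prule \<Rightarrow> nat \<Rightarrow> 'p list \<Rightarrow> bool" where
  "covers L q r d \<rho> \<longleftrightarrow>
     (\<exists>\<sigma>. (q, \<sigma>) \<in> full_irules L r \<and> take (2 * (d + 1)) \<sigma> = \<rho>) \<or>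
     (\<exists>h \<sigma>. (q, h, \<sigma>) \<in> stuck_irules L r \<and> d < h \<and> take (2 * (d + 1)) \<sigma> = \<rho>)"

lemma item_bar_iff:
  "(q, d', i', j') \<in> item_bar L (r, d, i, j, \<rho>) \<longleftrightarrow>
     d' = d \<and> i' = i \<and> j' = j \<and> covers L q r d \<rho>"
  unfolding covers_def item_bar.simps by blast

lemma items_bar_iff:
  "(q, d, i, j) \<in> items_bar L I \<longleftrightarrow> (\<exists>r \<rho>. (r, d, i, j, \<rho>) \<in> I \<and> covers L q r d \<rho>)"
proof
  assume "(q, d, i, j) \<in> items_bar L I"
  then obtain x where "x \<in> I" "(q, d, i, j) \<in> item_bar L x"
    by (auto simp: items_bar_def)
  then show "\<exists>r \<rho>. (r, d, i, j, \<rho>) \<in> I \<and> covers L q r d \<rho>"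
    by (cases x) (auto simp: item_bar_iff simp del: item_bar.simps)
next
  assume "\<exists>r \<rho>. (r, d, i, j, \<rho>) \<in> I \<and> covers L q r d \<rho>"
  then show "(q, d, i, j) \<in> items_bar L I"
    using item_bar_iff[of q d i j L _ d i j] by (auto simp: items_bar_def simp del: item_bar.simps)
qed

lemma Norm_iff:
  "((l, w), d, i, j) \<in> Norm I' \<longleftrightarrow> ((l, w), d, i, j) \<in> I' \<and> l \<noteq> Top \<and> drop d w \<noteq> [Bot]"
  by (auto simp: Norm_def)

text \<open>Both \<open>items_bar\<close> and \<open>Norm\<close> act item by item, so they commute
  with unions.\<close>

lemma items_sim_UN:
  assumes "\<And>n. items_sim L (A n) (B n)"
  shows "items_sim L (\<Union>n. A n) (\<Union>n. B n)"
proof -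
  have "items_bar L (\<Union>n. A n) = (\<Union>n. items_bar L (A n))"
    by (auto simp: items_bar_def)
  moreover have "Norm (\<Union>n. B n) = (\<Union>n. Norm (B n))"
    by (auto simp: Norm_def)
  ultimately show ?thesis
    using assms by (simp add: items_sim_def)
qed

lemma items_simD1:
  "items_sim L I I' \<Longrightarrow> (r, d, i, j, \<rho>) \<in> I \<Longrightarrow> covers L q r d \<rho> \<Longrightarrow> (q, d, i, j) \<in> I'"
  using items_bar_iff[of q d i j L I] Norm_iff[of "fst q" "snd q" d i j I']
  unfolding items_sim_def by auto

lemma items_simD2:
  assumes "items_sim L I I'" and "((l, v), d, i, j) \<in> I'" and "l \<noteq> Top" and "drop d v \<noteq> [Bot]"
  obtains r \<rho> where "(r, d, i, j, \<rho>) \<in> I" and "covers L (l, v) r d \<rho>"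
proof -
  have "((l, v), d, i, j) \<in> items_bar L I"
    using assms by (simp add: items_sim_def Norm_iff)
  then show ?thesis
    using that by (auto simp: items_bar_iff)
qed

lemma covers_irules_of: "covers L q r d \<rho> \<Longrightarrow> q \<in> irules_of L r"
  by (force simp: covers_def irules_of_def)

text \<open>The left side is a \<open>Sym\<close>, complete rules contain no \<open>Bot\<close>, and
  otherwise \<open>d < h\<close> leaves a \<open>Sym\<close> between the dot and the final
  \<open>Bot\<close>. Hence overlined items survive \<open>Norm\<close> by themselves.\<close>

lemma covers_Norm:
  assumes "covers L (l, v) r d \<rho>"
  shows "l \<noteq> Top" and "drop d v \<noteq> [Bot]"
proof -
  show "l \<noteq> Top"
    using assms by (auto simp: covers_def full_irules_def stuck_irules_def)
  have "Bot \<notin> set (drop d (isyms r n \<sigma>))" for n \<sigma>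
    by (meson Bot_notin_isyms in_set_dropD)
  then have "drop d (isyms r n \<sigma>) \<noteq> [Bot]" for n \<sigma>
    by (metis list.set_intros(1))
  then show "drop d v \<noteq> [Bot]"
    using assms by (auto simp: covers_def full_irules_def stuck_irules_def append_eq_Cons_conv)
qed

text \<open>By \<open>covers_Norm\<close>, only the inclusion starting from \<open>I'\<close> has to
  deal with \<open>Norm\<close>; the other one is plain membership in \<open>I'\<close>.\<close>

lemma items_simI:
  assumes "\<And>r d i j \<rho> q. (r, d, i, j, \<rho>) \<in> I \<Longrightarrow> covers L q r d \<rho> \<Longrightarrow> (q, d, i, j) \<in> I'"
    and "\<And>l v d i j. ((l, v), d, i, j) \<in> I' \<Longrightarrow> l \<noteq> Top \<Longrightarrow> drop d v \<noteq> [Bot] \<Longrightarrow>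
      \<exists>r \<rho>. (r, d, i, j, \<rho>) \<in> I \<and> covers L (l, v) r d \<rho>"
  shows "items_sim L I I'"
proof -
  have "((l, v), d, i, j) \<in> items_bar L I \<longleftrightarrow> ((l, v), d, i, j) \<in> Norm I'" for l v d i j
    unfolding items_bar_iff Norm_iff using assms covers_Norm[of L l v] by blast
  then show ?thesis
    unfolding items_sim_def by auto
qed

section \<open>Invariants of the items and shapes of induced rules\<close>

text \<open>A \<open>Top\<close> rule has a one-symbol body, so its items predict only while the dot
  is at 0; the second condition confines these predictions to position 0.\<close>

definition good_iitems :: "('s, 'p, 'c) pll \<Rightarrow> ('s, 'p) iitem set" where
  "good_iitems L = {(q, d, i, j) | q d i j.
     q \<in> irules L \<and> (fst q = Top \<and> d = 0 \<longrightarrow> j = 0)}"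

text \<open>Everything that \<open>Top\<close> items can predict at position 0. Since
  \<open>Norm\<close> drops those items, similarity says nothing about their predictions; having
  this set present beforehand means that they contribute nothing new.\<close>

definition start_iitems :: "('s, 'p, 'c) pll \<Rightarrow> ('s, 'p) iitem set" where
  "start_iitems L = {((Sym (Start L) (phi_start L) \<beta>, w), 0, 0, 0) | \<beta> w.
     (Sym (Start L) (phi_start L) \<beta>, w) \<in> irules L}"

definition wf_items :: "('s, 'p, 'c) pll \<Rightarrow> ('s, 'p) pitem set" where
  "wf_items L = {(r, d, i, j, \<rho>) | r d i j \<rho>.
     r \<in> Rules L \<and> d \<le> rlen r \<and> \<rho> \<in> chains (Params L) (take (Suc d) (rfuns r))}"

lemma irules_cases:
  assumes "(l, w) \<in> irules L"
  obtains \<beta> where "l = Top" and "w = [Sym (Start L) (phi_start L) \<beta>]" and "\<beta> \<in> Params L"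
  | r where "r \<in> Rules L" and "(l, w) \<in> irules_of L r"
  using assms by (auto simp: irules_def)

lemma irules_of_shape:
  assumes "(l, w) \<in> irules_of L r"
  shows "\<exists>\<alpha> \<beta>. l = Sym (lhs r) \<alpha> \<beta>" and "Top \<notin> set w"
  using assms by (auto simp: irules_of_def full_irules_def stuck_irules_def)

text \<open>Used to keep the exceptions of \<open>Norm\<close> away from symbols that are predicted
  or completed.\<close>

lemma irules_shape:
  assumes "(l, w) \<in> irules L"
  shows "l \<noteq> Bot" and "Top \<notin> set w"
  using assms by (auto elim!: irules_cases dest: irules_of_shape)

lemma irules_Top:
  assumes "(Top, w) \<in> irules L"
  shows "\<exists>\<beta>. \<beta> \<in> Params L \<and> w = [Sym (Start L) (phi_start L) \<beta>]"
  using assms by (auto elim!: irules_cases dest: irules_of_shape)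

section \<open>Introduction rules for the steps of both algorithms\<close>

lemma pella_PredictI:
  "(r, d, i, k, \<rho>) \<in> I \<Longrightarrow> d < rlen r \<Longrightarrow> r' \<in> Rules L \<Longrightarrow> lhs r' = rsyms r ! d \<Longrightarrow>
    (rfuns r' ! 0) [\<rho> ! (2 * d + 1)] = Some y \<Longrightarrow>
    (r', 0, k, k, [\<rho> ! (2 * d + 1), y]) \<in> Predict (pella L D) k I"
  unfolding pella_def steps.simps by blast

lemma pella_CompleteI:
  "(r, d, i, j, \<rho>) \<in> I \<Longrightarrow> d < rlen r \<Longrightarrow> lhs r' = rsyms r ! d \<Longrightarrow>
    (r', rlen r', j, k, \<xi>) \<in> I \<Longrightarrow> \<rho> ! (2 * d + 1) = \<xi> ! 0 \<Longrightarrow>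
    (rfuns r ! Suc d) (\<rho> @ [\<xi> ! (2 * rlen r' + 1)]) = Some y \<Longrightarrow>
    (r, Suc d, i, k, \<rho> @ [\<xi> ! (2 * rlen r' + 1), y]) \<in> Complete (pella L D) k I"
  unfolding pella_def steps.simps Suc_eq_plus1
  by (intro UnI2 CollectI exI conjI refl) (assumption | simp)+

lemma pella_ScanI:
  "(r, d, i, k, \<rho>) \<in> I \<Longrightarrow> d < rlen r \<Longrightarrow> (rsyms r ! d, \<rho> ! (2 * d + 1), \<beta>, c) \<in> T \<Longrightarrow>
    (rfuns r ! Suc d) (\<rho> @ [\<beta>]) = Some y \<Longrightarrow>
    (r, Suc d, i, k + length c, \<rho> @ [\<beta>, y]) \<in> Scan (pella L D) T k I"
  unfolding pella_def steps.simps Suc_eq_plus1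
  by (intro UnI2 CollectI exI conjI refl) (assumption | simp)+

lemma ella_PredictI:
  "((l, v), d, i, k) \<in> I \<Longrightarrow> d < length v \<Longrightarrow> (v ! d, w) \<in> irules L \<Longrightarrow>
    ((v ! d, w), 0, k, k) \<in> Predict (ella L D) k I"
  unfolding ella_def steps.simps by blast

lemma ella_CompleteI:
  "((l, v), d, i, j) \<in> I \<Longrightarrow> d < length v \<Longrightarrow> ((v ! d, w), length w, j, k) \<in> I \<Longrightarrow>
    ((l, v), Suc d, i, k) \<in> Complete (ella L D) k I"
  unfolding ella_def steps.simps Suc_eq_plus1 by blast

lemma ella_ScanI:
  "((l, v), d, i, k) \<in> I \<Longrightarrow> d < length v \<Longrightarrow> (v ! d, c) \<in> T \<Longrightarrow>
    ((l, v), Suc d, i, k + length c) \<in> Scan (ella L D) T k I"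
  unfolding ella_def steps.simps Suc_eq_plus1 by blast

section \<open>Well-formed parameterized items\<close>

context parameterized_local_lexing
begin

lemma rfuns_ran: "r \<in> Rules L \<Longrightarrow> i \<le> rlen r \<Longrightarrow> (rfuns r ! i) xs = Some y \<Longrightarrow> y \<in> Params L"
  using rule_funs[of r i] by (auto simp: partial_fun_on_def ran_def)

lemma rfuns_dom:
  "r \<in> Rules L \<Longrightarrow> i \<le> rlen r \<Longrightarrow> (rfuns r ! i) xs = Some y \<Longrightarrow> xs \<in> lists (Params L)"
  using rule_funs[of r i] by (auto simp: partial_fun_on_def dom_def)

lemma wf_items_length: "(r, d, i, j, \<rho>) \<in> wf_items L \<Longrightarrow> length \<rho> = 2 * d + 2"
  by (auto simp: wf_items_def dest!: chains_length)

lemma wf_items_mem: "(r, d, i, j, \<rho>) \<in> wf_items L \<Longrightarrow> n < 2 * d + 2 \<Longrightarrow> \<rho> ! n \<in> Params L"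
  by (auto simp: wf_items_def elim!: chains_mem)

lemma wf_items_initial:
  assumes "r \<in> Rules L" and "(rfuns r ! 0) [\<alpha>] = Some y"
  shows "(r, 0, i, j, [\<alpha>, y]) \<in> wf_items L"
proof -
  have "[\<alpha>, y] \<in> lists (Params L)"
    using rfuns_ran[OF assms(1) _ assms(2)] rfuns_dom[OF assms(1) _ assms(2)] by simp
  with assms show ?thesis
    by (simp add: wf_items_def chains_def take_Suc_conv_app_nth)
qed

text \<open>Definedness of the next function certifies its whole argument, \<open>\<beta>\<close>
  included, as parameters. Thus \<open>Scan\<close> preserves \<open>wf_items\<close> whatever the
  token set contains.\<close>

lemma wf_items_advance:
  assumes "(r, d, i, j, \<rho>) \<in> wf_items L" and "d < rlen r" and "(rfuns r ! Suc d) (\<rho> @ [\<beta>]) = Some y"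
  shows "(r, Suc d, i', j', \<rho> @ [\<beta>, y]) \<in> wf_items L"
proof -
  have r: "r \<in> Rules L" "\<rho> \<in> chains (Params L) (take (Suc d) (rfuns r))"
    using assms(1) by (auto simp: wf_items_def)
  have "y \<in> Params L" "\<beta> \<in> Params L"
    using rfuns_ran[OF r(1) _ assms(3)] rfuns_dom[OF r(1) _ assms(3)] assms(2) by auto
  then have "\<rho> @ [\<beta>, y] \<in> chains (Params L) (take (Suc d) (rfuns r) @ [rfuns r ! Suc d])"
    by (intro chains_append r assms(3))
  then show ?thesis
    using assms(2) r by (simp add: wf_items_def take_Suc_conv_app_nth)
qed

section \<open>Existence of covering rules and movement of the dot\<close>

text \<open>Supplies the parameter returned by a predicted left side: the last entry of the chain of
  a complete rule, or the parameter attached freely to a rule ending in \<open>Bot\<close>.\<close>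

lemma covers_lhs:
  assumes "(r, d, i, j, \<rho>) \<in> wf_items L" and "covers L q r d \<rho>"
  shows "\<exists>\<beta>\<in>Params L. fst q = Sym (lhs r) (\<rho> ! 0) \<beta>"
proof -
  have "\<sigma> ! (2 * rlen r + 1) \<in> Params L" if "\<sigma> \<in> chains (Params L) (rfuns r)" for \<sigma>
    using that by (rule chains_mem) simp
  with assms show ?thesis
    by (auto simp: covers_def full_irules_def stuck_irules_def)
qed

text \<open>The parameter \<open>\<beta>\<close> is the entry after \<open>\<rho>\<close> in the
  sequence behind the rule. A function value follows it there unless a rule ending in
  \<open>Bot\<close> has \<open>h = d + 1\<close>, and then only \<open>Bot\<close> remains after
  the advance.\<close>

lemma covers_advance:
  assumes wf: "(r, d, i, j, \<rho>) \<in> wf_items L" and cov: "covers L (l, v) r d \<rho>" and d: "d < length v"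
  shows "d < rlen r \<and> (\<exists>\<beta>\<in>Params L. v ! d = Sym (rsyms r ! d) (\<rho> ! (2 * d + 1)) \<beta> \<and>
    (drop (Suc d) v \<noteq> [Bot] \<longrightarrow> (\<exists>y. (rfuns r ! Suc d) (\<rho> @ [\<beta>]) = Some y \<and>
       covers L (l, v) r (Suc d) (\<rho> @ [\<beta>, y]))))"
proof -
  consider (full) \<sigma> where "((l, v), \<sigma>) \<in> full_irules L r" "take (2 * (d + 1)) \<sigma> = \<rho>"
    | (stuck) h \<sigma> where "((l, v), h, \<sigma>) \<in> stuck_irules L r" "d < h" "take (2 * (d + 1)) \<sigma> = \<rho>"
    using cov by (auto simp: covers_def)
  then show ?thesis
  proof cases
    case full
    then have \<sigma>: "\<sigma> \<in> chains (Params L) (rfuns r)" and v: "v = isyms r (rlen r) \<sigma>"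
      by (auto simp: full_irules_def)
    have len: "length \<sigma> = 2 * rlen r + 2"
      using chains_length[OF \<sigma>] by simp
    have d': "d < rlen r" using d v by simp
    \<comment> \<open>With indices from 1, these are the parameter returned by symbol
      \<open>d + 1\<close> and the value of function \<open>d + 2\<close>, which is the output when
      \<open>d + 1 = rlen r\<close>.\<close>
    let ?\<beta> = "\<sigma> ! (2 * d + 2)" and ?y = "\<sigma> ! (2 * d + 3)"
    have \<rho>: "take (2 * Suc d + 1) \<sigma> = \<rho> @ [?\<beta>]" "take (2 * (Suc d + 1)) \<sigma> = \<rho> @ [?\<beta>, ?y]"
      using full(2) d' len by (auto simp: take_Suc_conv_app_nth eval_nat_numeral)
    have "(rfuns r ! Suc d) (\<rho> @ [?\<beta>]) = Some ?y"
      using chains_nth[OF \<sigma>, of "Suc d"] d' unfolding \<rho> by (simp add: eval_nat_numeral)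
    moreover have "?\<beta> \<in> Params L"
      using \<sigma> d' by (auto intro: chains_mem)
    moreover have "covers L (l, v) r (Suc d) (\<rho> @ [?\<beta>, ?y])"
      using full \<rho> by (auto simp: covers_def)
    moreover have "v ! d = Sym (rsyms r ! d) (\<rho> ! (2 * d + 1)) ?\<beta>"
      using d' v full(2) by auto
    ultimately show ?thesis
      using d' by blast
  next
    case stuck
    then obtain \<beta>h where h: "h \<le> rlen r" and \<sigma>: "\<sigma> \<in> chains (Params L) (take h (rfuns r))"
      and v: "v = isyms r h (\<sigma> @ [\<beta>h]) @ [Bot]" and bh: "\<beta>h \<in> Params L"
      by (auto simp: stuck_irules_def)
    have len: "length \<sigma> = 2 * h"
      using chains_length[OF \<sigma>] h by simp
    \<comment> \<open>The length of \<open>\<sigma>\<close> is \<open>2 * h\<close>, so the index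
      \<open>2 * d + 2\<close> hits the appended \<open>\<beta>h\<close> exactly when
      \<open>d + 1 = h\<close>. The entry \<open>?y\<close> enters only when
      \<open>d + 1 < h\<close>, where it lies within \<open>\<sigma>\<close>.\<close>
    let ?\<beta> = "(\<sigma> @ [\<beta>h]) ! (2 * d + 2)" and ?y = "\<sigma> ! (2 * d + 3)"
    have vd: "v ! d = Sym (rsyms r ! d) (\<rho> ! (2 * d + 1)) ?\<beta>"
      using stuck(2,3) v len by (auto simp: nth_append)
    have b: "?\<beta> \<in> Params L"
    proof (cases "Suc d = h")
      case True
      then have "(\<sigma> @ [\<beta>h]) ! (2 * d + 2) = \<beta>h"
        using len by (auto simp: nth_append)
      with bh show ?thesis by simp
    next
      case False
      with stuck(2) have "2 * d + 2 < 2 * h" by simp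
      then show ?thesis
        using chains_mem[OF \<sigma>, of "2 * d + 2"] len h by (simp add: nth_append)
    qed
    show ?thesis
    proof (cases "Suc d = h")
      case True
      then have "drop (Suc d) v = [Bot]" using v by simp
      with True vd b h show ?thesis by auto
    next
      case False
      with stuck(2) have d': "Suc d < h" by simp
      have \<beta>: "?\<beta> = \<sigma> ! (2 * d + 2)"
        using d' len by (simp add: nth_append)
      have \<rho>: "take (2 * Suc d + 1) \<sigma> = \<rho> @ [?\<beta>]" "take (2 * (Suc d + 1)) \<sigma> = \<rho> @ [?\<beta>, ?y]"
        unfolding \<beta> using stuck(3) d' len by (auto simp: take_Suc_conv_app_nth eval_nat_numeral)
      have "(rfuns r ! Suc d) (\<rho> @ [?\<beta>]) = Some ?y"
        using chains_nth[OF \<sigma>, of "Suc d"] d' h unfolding \<rho> by (simp add: eval_nat_numeral)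
      moreover have "covers L (l, v) r (Suc d) (\<rho> @ [?\<beta>, ?y])"
        using stuck \<rho> d' by (auto simp: covers_def)
      ultimately show ?thesis
        using d' h vd b by auto
    qed
  qed
qed

text \<open>The sequence behind the longer prefix also serves for the shorter one, and its entry
  right after \<open>\<rho>\<close> is \<open>\<beta>\<close>.\<close>

lemma covers_retreat:
  assumes len\<rho>: "length \<rho> = 2 * d + 2" and d: "d < rlen r"
    and cov: "covers L (l, v) r (Suc d) (\<rho> @ [\<beta>, y])"
  shows "covers L (l, v) r d \<rho> \<and> d < length v \<and> v ! d = Sym (rsyms r ! d) (\<rho> ! (2 * d + 1)) \<beta>"
proof -
  have pre: "take (2 * (d + 1)) \<sigma> = \<rho> \<and> \<sigma> ! (2 * d + 1) = \<rho> ! (2 * d + 1) \<and> \<sigma> ! (2 * d + 2) = \<beta>"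
    if "take (2 * (Suc d + 1)) \<sigma> = \<rho> @ [\<beta>, y]" for \<sigma>
  proof -
    have "take (2 * (d + 1)) (take (2 * (Suc d + 1)) \<sigma>) = \<rho>"
      unfolding that using len\<rho> by simp
    moreover have "take (2 * (Suc d + 1)) \<sigma> ! n = (\<rho> @ [\<beta>, y]) ! n" for n
      unfolding that ..
    from this[of "2 * d + 1"] this[of "2 * d + 2"]
    have "\<sigma> ! (2 * d + 1) = \<rho> ! (2 * d + 1)" "\<sigma> ! (2 * d + 2) = \<beta>"
      using len\<rho> by (simp_all add: nth_append)
    ultimately show ?thesis by simp
  qed
  consider (full) \<sigma> where "((l, v), \<sigma>) \<in> full_irules L r" "take (2 * (Suc d + 1)) \<sigma> = \<rho> @ [\<beta>, y]"
    | (stuck) h \<sigma> where "((l, v), h, \<sigma>) \<in> stuck_irules L r" "Suc d < h"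
        "take (2 * (Suc d + 1)) \<sigma> = \<rho> @ [\<beta>, y]"
    using cov by (auto simp: covers_def)
  then show ?thesis
  proof cases
    case full
    then have "covers L (l, v) r d \<rho>"
      using pre by (auto simp: covers_def)
    moreover have "v = isyms r (rlen r) \<sigma>"
      using full by (auto simp: full_irules_def)
    ultimately show ?thesis
      using d pre[OF full(2)] by simp
  next
    case stuck
    then have "covers L (l, v) r d \<rho>"
      using pre Suc_lessD unfolding covers_def by blast
    moreover obtain \<beta>h where "v = isyms r h (\<sigma> @ [\<beta>h]) @ [Bot]" and "h \<le> rlen r"
      and "\<sigma> \<in> chains (Params L) (take h (rfuns r))"
      using stuck by (auto simp: stuck_irules_def)
    moreover from this have "length \<sigma> = 2 * h"
      using chains_length by fastforce
    ultimately show ?thesis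
      using stuck(2) pre[OF stuck(3)] by (simp add: nth_append)
  qed
qed

text \<open>A rule ending in \<open>Bot\<close> has length \<open>h + 1\<close> while
  \<open>d < h\<close>, so a dot at the very end belongs to a complete rule, whose sequence is all
  of \<open>\<rho>\<close>.\<close>

lemma covers_complete:
  assumes "(r, d, i, j, \<rho>) \<in> wf_items L" and "covers L (l, v) r d \<rho>" and "d = length v"
  shows "d = rlen r \<and> l = Sym (lhs r) (\<rho> ! 0) (\<rho> ! (2 * rlen r + 1))"
  using assms by (auto simp: covers_def full_irules_def stuck_irules_def)

lemma covers_complete_ex:
  assumes "(r, rlen r, i, j, \<xi>) \<in> wf_items L"
  shows "\<exists>v. length v = rlen r \<and>
    covers L (Sym (lhs r) (\<xi> ! 0) (\<xi> ! (2 * rlen r + 1)), v) r (rlen r) \<xi>"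
proof -
  let ?q = "(Sym (lhs r) (\<xi> ! 0) (\<xi> ! (2 * rlen r + 1)), isyms r (rlen r) \<xi>)"
  have "(?q, \<xi>) \<in> full_irules L r"
    using assms by (auto simp: full_irules_def wf_items_def)
  moreover have "take (2 * (rlen r + 1)) \<xi> = \<xi>"
    using wf_items_length[OF assms] by simp
  ultimately have "covers L ?q r (rlen r) \<xi>"
    unfolding covers_def by blast
  then show ?thesis
    by (metis length_isyms)
qed

text \<open>Continue the parameter sequence with arbitrary parameters until the rule is
  exhausted or the next function is undefined.\<close>

lemma covers_next_ex_aux:
  assumes "(r, d, i, j, \<rho>) \<in> wf_items L" and "d < rlen r" and "\<beta> \<in> Params L"
    and ext: "\<And>y. (rfuns r ! Suc d) (\<rho> @ [\<beta>]) = Some y \<Longrightarrow>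
      \<exists>q. covers L q r (Suc d) (\<rho> @ [\<beta>, y])"
  shows "\<exists>l v. covers L (l, v) r d \<rho> \<and> d < length v \<and>
    v ! d = Sym (rsyms r ! d) (\<rho> ! (2 * d + 1)) \<beta>"
proof (cases "(rfuns r ! Suc d) (\<rho> @ [\<beta>])")
  case None
  have \<rho>: "length \<rho> = 2 * d + 2" "\<rho> \<in> chains (Params L) (take (Suc d) (rfuns r))"
    using assms(1) wf_items_length by (auto simp: wf_items_def)
  \<comment> \<open>The undefined function gives a rule ending in \<open>Bot\<close> with
    \<open>h = d + 1\<close>. Its left side may return any parameter, so \<open>\<beta>\<close>
    serves there too; inside the body \<open>\<beta>\<close> is prescribed.\<close>
  let ?q = "(Sym (lhs r) (\<rho> ! 0) \<beta>, isyms r (Suc d) (\<rho> @ [\<beta>]) @ [Bot])"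
  have "(?q, Suc d, \<rho>) \<in> stuck_irules L r"
    unfolding stuck_irules_def mem_Collect_eq using None \<rho> assms(2,3)
    by (intro exI[of _ "Suc d"] exI[of _ \<rho>] exI[of _ \<beta>]) simp
  moreover have "take (2 * (d + 1)) \<rho> = \<rho>"
    using \<rho> by simp
  ultimately have "covers L ?q r d \<rho>"
    unfolding covers_def by blast
  then show ?thesis
    using \<rho> by (intro exI conjI) (auto simp: nth_append)
next
  case (Some y)
  then obtain l v where "covers L (l, v) r (Suc d) (\<rho> @ [\<beta>, y])"
    using ext by force
  then show ?thesis
    using covers_retreat[OF wf_items_length[OF assms(1)] assms(2)] by blast
qed

text \<open>Induction on the number of symbols after the dot: the induction hypothesis provides
  \<open>ext\<close> of the auxiliary lemma, and nonemptiness of the parameter set provides an entry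
  to append.\<close>

lemma covers_ex: "(r, d, i, j, \<rho>) \<in> wf_items L \<Longrightarrow> \<exists>q. covers L q r d \<rho>"
proof (induction "rlen r - d" arbitrary: d \<rho>)
  case 0
  then have "d = rlen r" by (simp add: wf_items_def)
  with 0 show ?case
    using covers_complete_ex by blast
next
  case (Suc n)
  obtain \<beta> where \<beta>: "\<beta> \<in> Params L"
    using params_nonempty by blast
  from Suc have d: "d < rlen r" by simp
  then have "\<exists>q. covers L q r (Suc d) (\<rho> @ [\<beta>, y])"
    if "(rfuns r ! Suc d) (\<rho> @ [\<beta>]) = Some y" for y
    using Suc.hyps(1)[of "Suc d"] Suc.hyps(2) wf_items_advance[OF Suc.prems d that] by simp
  then show ?case
    using covers_next_ex_aux[OF Suc.prems d \<beta>] by blast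
qed

text \<open>Because \<open>\<beta>\<close> is arbitrary, the covering rule can be fitted to the left
  side of a prediction or to a token found by \<open>Lex\<close>.\<close>

lemma covers_next_ex:
  assumes "(r, d, i, j, \<rho>) \<in> wf_items L" and "d < rlen r" and "\<beta> \<in> Params L"
  shows "\<exists>l v. covers L (l, v) r d \<rho> \<and> d < length v \<and>
    v ! d = Sym (rsyms r ! d) (\<rho> ! (2 * d + 1)) \<beta>"
  using covers_next_ex_aux[OF assms] covers_ex[OF wf_items_advance[OF assms(1,2)]] by blast

text \<open>A prefix for dot 0 already contains one function value. Rules ending in
  \<open>Bot\<close> have \<open>1 \<le> h\<close>, so their sequences also begin with a parameter
  and the value of the first function there.\<close>

lemma irules_of_covers:
  assumes "r \<in> Rules L" and "(l, w) \<in> irules_of L r"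
  shows "\<exists>\<alpha> \<beta> y. l = Sym (lhs r) \<alpha> \<beta> \<and> \<beta> \<in> Params L \<and> (rfuns r ! 0) [\<alpha>] = Some y \<and>
    covers L (l, w) r 0 [\<alpha>, y]"
proof -
  have prefix: "(rfuns r ! 0) [\<sigma> ! 0] = Some (\<sigma> ! 1) \<and> take (2 * (0 + 1)) \<sigma> = [\<sigma> ! 0, \<sigma> ! 1]"
    if "\<sigma> \<in> chains (Params L) (take n (rfuns r))" "0 < n" for \<sigma> n
  proof -
    have "2 \<le> length \<sigma>"
      using chains_length[OF that(1)] that(2) by simp
    then obtain a b \<tau> where "\<sigma> = a # b # \<tau>"
      by (metis Suc_le_length_iff numeral_2_eq_2)
    then show ?thesis
      using chains_nth[OF that(1), of 0] that(2) by simp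
  qed
  consider (full) \<sigma> where "((l, w), \<sigma>) \<in> full_irules L r"
    | (stuck) h \<sigma> where "((l, w), h, \<sigma>) \<in> stuck_irules L r"
    using assms(2) by (auto simp: irules_of_def)
  then show ?thesis
  proof cases
    case full
    then have \<sigma>: "\<sigma> \<in> chains (Params L) (rfuns r)"
      and l: "l = Sym (lhs r) (\<sigma> ! 0) (\<sigma> ! (2 * rlen r + 1))"
      by (auto simp: full_irules_def)
    have "(rfuns r ! 0) [\<sigma> ! 0] = Some (\<sigma> ! 1) \<and> take (2 * (0 + 1)) \<sigma> = [\<sigma> ! 0, \<sigma> ! 1]"
      using prefix[of \<sigma> "Suc (rlen r)"] \<sigma> by simp
    moreover from this have "covers L (l, w) r 0 [\<sigma> ! 0, \<sigma> ! 1]"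
      using full unfolding covers_def by blast
    moreover have "\<sigma> ! (2 * rlen r + 1) \<in> Params L"
      by (rule chains_mem[OF \<sigma>]) simp
    ultimately show ?thesis
      using l by blast
  next
    case stuck
    then obtain \<beta> where \<sigma>: "\<sigma> \<in> chains (Params L) (take h (rfuns r))" "0 < h"
      and l: "l = Sym (lhs r) (\<sigma> ! 0) \<beta>" "\<beta> \<in> Params L"
      by (auto simp: stuck_irules_def)
    moreover from this have "covers L (l, w) r 0 [\<sigma> ! 0, \<sigma> ! 1]"
      using stuck prefix[OF \<sigma>] unfolding covers_def by blast
    ultimately show ?thesis
      using prefix[OF \<sigma>] by blast
  qed
qed

section \<open>Preservation of the invariants\<close>

lemma Predict_wf: "I \<subseteq> wf_items L \<Longrightarrow> Predict (pella L D) k I \<subseteq> wf_items L"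
  by (auto simp: pella_def intro: wf_items_initial)

lemma Complete_wf: "I \<subseteq> wf_items L \<Longrightarrow> Complete (pella L D) k I \<subseteq> wf_items L"
  by (auto simp: pella_def intro: wf_items_advance)

lemma Scan_wf: "I \<subseteq> wf_items L \<Longrightarrow> Scan (pella L D) T k I \<subseteq> wf_items L"
  by (auto simp: pella_def intro: wf_items_advance)

lemma pi_step_wf: "I \<subseteq> wf_items L \<Longrightarrow> pi_step (pella L D) k T I \<subseteq> wf_items L"
  unfolding pi_step_def by (rule limit_least) (auto simp only: o_apply Predict_wf Complete_wf Scan_wf)

lemma \<J>_wf: "\<J> (pella L D) k u \<subseteq> wf_items L"
proof (induction k arbitrary: u)
  case 0
  have "Init (pella L D) \<subseteq> wf_items L"
    by (auto simp: pella_def intro: wf_items_initial)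
  then show ?case
    by (induction u) (simp_all add: pi_step_wf)
next
  case (Suc k)
  then have "(\<Union>u. \<J> (pella L D) k u) \<subseteq> wf_items L" by blast
  then show ?case
    by (induction u) (simp_all add: pi_step_wf)
qed

text \<open>Since \<open>Top\<close> occurs in no body, a prediction never creates an item with left
  side \<open>Top\<close>.\<close>

lemma Predict_good: "I \<subseteq> good_iitems L \<Longrightarrow> Predict (ella L D) k I \<subseteq> good_iitems L"
proof
  fix x assume I: "I \<subseteq> good_iitems L" and x: "x \<in> Predict (ella L D) k I"
  have "v ! d \<noteq> Top" if "((l, v), d, i, k) \<in> I" "d < length v" for l v d i
  proof -
    from that I have "(l, v) \<in> irules L" by (auto simp: good_iitems_def)
    with that(2) show ?thesis
      using irules_shape(2) nth_mem by metis
  qed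
  with I x show "x \<in> good_iitems L"
    by (auto simp: ella_def good_iitems_def)
qed

lemma Complete_good: "I \<subseteq> good_iitems L \<Longrightarrow> Complete (ella L D) k I \<subseteq> good_iitems L"
  by (auto simp: ella_def good_iitems_def)

lemma Scan_good: "I \<subseteq> good_iitems L \<Longrightarrow> Scan (ella L D) T k I \<subseteq> good_iitems L"
  by (auto simp: ella_def good_iitems_def)

lemma pi_step_good: "I \<subseteq> good_iitems L \<Longrightarrow> pi_step (ella L D) k T I \<subseteq> good_iitems L"
  unfolding pi_step_def by (rule limit_least) (auto simp only: o_apply Predict_good Complete_good Scan_good)

lemma \<J>_good: "\<J> (ella L D) k u \<subseteq> good_iitems L"
proof (induction k arbitrary: u)
  case 0
  have "Init (ella L D) \<subseteq> good_iitems L"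
    by (auto simp: ella_def good_iitems_def)
  then show ?case
    by (induction u) (simp_all add: pi_step_good)
next
  case (Suc k)
  then have "(\<Union>u. \<J> (ella L D) k u) \<subseteq> good_iitems L" by blast
  then show ?case
    by (induction u) (simp_all add: pi_step_good)
qed

lemma ella_extensive:
  "I \<subseteq> Predict (ella L D) k I" "I \<subseteq> Complete (ella L D) k I" "I \<subseteq> Scan (ella L D) T k I"
  by (auto simp: ella_def)

text \<open>A single prediction from the initial items produces this set, and all later sets contain
  it.\<close>

lemma start_iitems_subset: "start_iitems L \<subseteq> \<J> (ella L D) 0 u"
proof -
  let ?E = "ella L D"
  have "start_iitems L \<subseteq> Predict ?E 0 (Init ?E)"
  proof
    fix x assume "x \<in> start_iitems L"
    then obtain \<beta> w where x: "x = ((Sym (Start L) (phi_start L) \<beta>, w), 0, 0, 0)"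
      and w: "(Sym (Start L) (phi_start L) \<beta>, w) \<in> irules L"
      by (auto simp: start_iitems_def)
    from w obtain r where "r \<in> Rules L" "(Sym (Start L) (phi_start L) \<beta>, w) \<in> irules_of L r"
      by (rule irules_cases) auto
    \<comment> \<open>Left sides of induced rules return only parameters, so the matching
      \<open>Top\<close> rule is in the grammar.\<close>
    from irules_of_covers[OF this] have "\<beta> \<in> Params L" by auto
    then have "((Top, [Sym (Start L) (phi_start L) \<beta>]), 0, 0, 0) \<in> Init ?E"
      by (simp add: ella_def irules_def)
    with w show "x \<in> Predict ?E 0 (Init ?E)"
      using ella_PredictI[of Top "[Sym (Start L) (phi_start L) \<beta>]" 0 0 0 _ w] unfolding x by simp
  qed
  also have "\<dots> \<subseteq> (Scan ?E {} 0 \<circ> Complete ?E 0 \<circ> Predict ?E 0) (Init ?E)"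
    unfolding o_apply by (meson ella_extensive subset_trans)
  also have "\<dots> \<subseteq> \<J> ?E 0 0"
    using iterate_subset_limit[of 1 "Scan ?E {} 0 \<circ> Complete ?E 0 \<circ> Predict ?E 0" "Init ?E"]
    unfolding \<J>.simps pi_step_def by simp
  also have "\<dots> \<subseteq> \<J> ?E 0 u"
    by (rule \<J>_0_subset)
  finally show ?thesis .
qed

section \<open>Simulation of the single steps on items\<close>

lemma Predict_sim:
  assumes sim: "items_sim L I I'" and wf: "I \<subseteq> wf_items L" and good: "I' \<subseteq> good_iitems L"
    and start: "k = 0 \<longrightarrow> start_iitems L \<subseteq> I'"
  shows "items_sim L (Predict (pella L D) k I) (Predict (ella L D) k I')"
proof (rule items_simI)
  fix r d i j \<rho> q
  assume mem: "(r, d, i, j, \<rho>) \<in> Predict (pella L D) k I" and cov: "covers L q r d \<rho>"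
  show "(q, d, i, j) \<in> Predict (ella L D) k I'"
  proof (cases "(r, d, i, j, \<rho>) \<in> I")
    case True
    then show ?thesis
      using items_simD1[OF sim _ cov] ella_extensive(1) by blast
  next
    case False
    then obtain y r0 d0 i0 \<rho>0 where new: "d = 0" "i = k" "j = k" "\<rho> = [\<rho>0 ! (2 * d0 + 1), y]"
      "(r0, d0, i0, k, \<rho>0) \<in> I" "d0 < rlen r0" "r \<in> Rules L" "lhs r = rsyms r0 ! d0"
      "(rfuns r ! 0) [\<rho>0 ! (2 * d0 + 1)] = Some y"
      using mem by (auto simp: pella_def)
    have "(r, d, i, j, \<rho>) \<in> wf_items L"
      using new wf_items_initial by simp
    from covers_lhs[OF this cov] obtain \<beta> w where
      q: "\<beta> \<in> Params L" "q = (Sym (rsyms r0 ! d0) (\<rho>0 ! (2 * d0 + 1)) \<beta>, w)"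
      using new by (cases q) auto
    \<comment> \<open>The left side of \<open>q\<close> fixes \<open>\<beta>\<close>; a covering
      rule of the predicting item is chosen whose next symbol returns the same
      \<open>\<beta>\<close>.\<close>
    obtain l v where "covers L (l, v) r0 d0 \<rho>0" "d0 < length v"
      "v ! d0 = Sym (rsyms r0 ! d0) (\<rho>0 ! (2 * d0 + 1)) \<beta>"
      using covers_next_ex[of r0 d0 i0 k \<rho>0 \<beta>] new wf q by blast
    moreover from this have "((l, v), d0, i0, k) \<in> I'"
      using items_simD1[OF sim new(5)] by blast
    moreover have "q \<in> irules L"
      using covers_irules_of[OF cov] new by (auto simp: irules_def)
    ultimately show ?thesis
      using new q ella_PredictI[of l v d0 i0 k I' w] by simp
  qed
next
  fix l v d i j
  assume mem: "((l, v), d, i, j) \<in> Predict (ella L D) k I'" and l: "l \<noteq> Top" and v: "drop d v \<noteq> [Bot]"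
  show "\<exists>r \<rho>. (r, d, i, j, \<rho>) \<in> Predict (pella L D) k I \<and> covers L (l, v) r d \<rho>"
  proof (cases "((l, v), d, i, j) \<in> I'")
    case True
    with sim l v show ?thesis
      by (auto elim!: items_simD2 simp: pella_def)
  next
    case False
    then obtain l0 v0 d0 i0 where new: "d = 0" "i = k" "j = k" "((l0, v0), d0, i0, k) \<in> I'"
      "d0 < length v0" "v0 ! d0 = l" "(l, v) \<in> irules L"
      using mem by (auto simp: ella_def)
    have q0: "(l0, v0) \<in> irules L" and z: "l0 = Top \<Longrightarrow> d0 = 0 \<Longrightarrow> k = 0"
      using good new(4) by (auto simp: good_iitems_def)
    \<comment> \<open>The one-symbol body of a \<open>Top\<close> rule forces \<open>d0 = 0\<close>,
      and \<open>good_iitems\<close> then forces \<open>k = 0\<close>. The prediction would be a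
      start item, which is in \<open>I'\<close> already.\<close>
    have "l0 \<noteq> Top"
    proof
      assume top: "l0 = Top"
      with q0 irules_Top obtain \<beta> where "v0 = [Sym (Start L) (phi_start L) \<beta>]" by blast
      with new top z have "((l, v), d, i, j) \<in> start_iitems L" "k = 0"
        by (auto simp: start_iitems_def)
      with start False show False by blast
    qed
    moreover have "l \<noteq> Bot"
      using new(7) irules_shape(1) by blast
    then have "drop d0 v0 \<noteq> [Bot]"
      using new by (metis Cons_nth_drop_Suc list.inject)
    ultimately obtain r0 \<rho>0 where 0: "(r0, d0, i0, k, \<rho>0) \<in> I" "covers L (l0, v0) r0 d0 \<rho>0"
      using items_simD2[OF sim new(4)] by blast
    then obtain \<beta>0 where dot: "d0 < rlen r0" "l = Sym (rsyms r0 ! d0) (\<rho>0 ! (2 * d0 + 1)) \<beta>0"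
      using covers_advance[of r0 d0 i0 k \<rho>0] wf new by blast
    obtain r where r: "r \<in> Rules L" "(l, v) \<in> irules_of L r"
      using new(7) by (rule irules_cases) (use l in auto)
    \<comment> \<open>That an induced rule with this left side exists at all shows the first
      function of \<open>r\<close> to be defined at the predicted parameter.\<close>
    from irules_of_covers[OF this] dot obtain y where
      "lhs r = rsyms r0 ! d0" "(rfuns r ! 0) [\<rho>0 ! (2 * d0 + 1)] = Some y"
      "covers L (l, v) r 0 [\<rho>0 ! (2 * d0 + 1), y]"
      by auto
    moreover from this have "(r, 0, k, k, [\<rho>0 ! (2 * d0 + 1), y]) \<in> Predict (pella L D) k I"
      using 0 dot r by (intro pella_PredictI)
    ultimately show ?thesis
      using new by blast
  qed
qed

lemma Complete_sim:
  assumes sim: "items_sim L I I'" and wf: "I \<subseteq> wf_items L" and good: "I' \<subseteq> good_iitems L"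
  shows "items_sim L (Complete (pella L D) k I) (Complete (ella L D) k I')"
proof (rule items_simI)
  fix r d i j \<rho> q
  assume mem: "(r, d, i, j, \<rho>) \<in> Complete (pella L D) k I" and cov: "covers L q r d \<rho>"
  show "(q, d, i, j) \<in> Complete (ella L D) k I'"
  proof (cases "(r, d, i, j, \<rho>) \<in> I")
    case True
    then show ?thesis
      using items_simD1[OF sim _ cov] ella_extensive(2) by blast
  next
    case False
    then obtain d0 j0 \<rho>0 r' \<xi> y where new: "d = Suc d0" "j = k"
      "\<rho> = \<rho>0 @ [\<xi> ! (2 * rlen r' + 1), y]" "(r, d0, i, j0, \<rho>0) \<in> I" "d0 < rlen r"
      "lhs r' = rsyms r ! d0" "(r', rlen r', j0, k, \<xi>) \<in> I" "\<rho>0 ! (2 * d0 + 1) = \<xi> ! 0"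
      using mem by (auto simp: pella_def)
    obtain l v where q: "q = (l, v)" by (cases q)
    have prev: "covers L (l, v) r d0 \<rho>0" "d0 < length v"
      "v ! d0 = Sym (lhs r') (\<xi> ! 0) (\<xi> ! (2 * rlen r' + 1))"
      using covers_retreat[OF _ new(5)] wf_items_length[of r d0 i j0 \<rho>0] new wf cov
      unfolding q by auto
    \<comment> \<open>The left side of this completed rule is exactly \<open>v ! d0\<close>.\<close>
    obtain w where w: "length w = rlen r'"
      "covers L (Sym (lhs r') (\<xi> ! 0) (\<xi> ! (2 * rlen r' + 1)), w) r' (rlen r') \<xi>"
      using covers_complete_ex[of r' j0 k \<xi>] new(7) wf by blast
    have "((l, v), d0, i, j0) \<in> I'" "((v ! d0, w), length w, j0, k) \<in> I'"
      using items_simD1[OF sim new(4) prev(1)] items_simD1[OF sim new(7) w(2)] w(1) prev by auto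
    with prev new show ?thesis
      unfolding q by (auto intro: ella_CompleteI)
  qed
next
  fix l v d i j
  assume mem: "((l, v), d, i, j) \<in> Complete (ella L D) k I'" and l: "l \<noteq> Top" and v: "drop d v \<noteq> [Bot]"
  show "\<exists>r \<rho>. (r, d, i, j, \<rho>) \<in> Complete (pella L D) k I \<and> covers L (l, v) r d \<rho>"
  proof (cases "((l, v), d, i, j) \<in> I'")
    case True
    with sim l v show ?thesis
      by (auto elim!: items_simD2 simp: pella_def)
  next
    case False
    then obtain d0 j0 w where new: "d = Suc d0" "j = k" "((l, v), d0, i, j0) \<in> I'" "d0 < length v"
      "((v ! d0, w), length w, j0, k) \<in> I'"
      using mem by (auto simp: ella_def)
    have irule: "(v ! d0, w) \<in> irules L" "(l, v) \<in> irules L"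
      using good new by (auto simp: good_iitems_def)
    \<comment> \<open>This symbol heads one rule and stands in the body of another. Therefore both
      source items survive \<open>Norm\<close> and come from parameterized items.\<close>
    have "v ! d0 \<noteq> Bot" "v ! d0 \<noteq> Top"
      using irules_shape[OF irule(1)] irules_shape[OF irule(2)] new(4) nth_mem by metis+
    moreover from this have "drop d0 v \<noteq> [Bot]"
      using new by (metis Cons_nth_drop_Suc list.inject)
    ultimately obtain r \<rho> r' \<xi> where 0: "(r, d0, i, j0, \<rho>) \<in> I" "covers L (l, v) r d0 \<rho>"
      "(r', length w, j0, k, \<xi>) \<in> I" "covers L (v ! d0, w) r' (length w) \<xi>"
      using items_simD2[OF sim new(3) l] items_simD2[OF sim new(5)] by (metis drop_all le_refl list.distinct(1))
    have c: "length w = rlen r'" "v ! d0 = Sym (lhs r') (\<xi> ! 0) (\<xi> ! (2 * rlen r' + 1))"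
      using covers_complete[OF _ 0(4)] 0(3) wf by auto
    \<comment> \<open>The advanced item is assumed to survive \<open>Norm\<close>, which rules out
      the undefined case of \<open>covers_advance\<close>.\<close>
    obtain y where y: "d0 < rlen r" "rsyms r ! d0 = lhs r'" "\<rho> ! (2 * d0 + 1) = \<xi> ! 0"
      "(rfuns r ! Suc d0) (\<rho> @ [\<xi> ! (2 * rlen r' + 1)]) = Some y"
      "covers L (l, v) r (Suc d0) (\<rho> @ [\<xi> ! (2 * rlen r' + 1), y])"
      using covers_advance[OF _ 0(2) new(4)] 0(1) wf c v new(1) by fastforce
    then have "(r, Suc d0, i, k, \<rho> @ [\<xi> ! (2 * rlen r' + 1), y]) \<in> Complete (pella L D) k I"
      using 0(1,3) c(1) by (intro pella_CompleteI) simp_all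
    with y new show ?thesis by blast
  qed
qed

text \<open>A token carries the parameter it returns, so the two inclusions are the dot movements
  \<open>covers_retreat\<close> and \<open>covers_advance\<close> with that parameter as
  \<open>\<beta>\<close>.\<close>

lemma Scan_sim:
  assumes sim: "items_sim L I I'" and wf: "I \<subseteq> wf_items L"
  shows "items_sim L (Scan (pella L D) T k I) (Scan (ella L D) (utok ` T) k I')"
proof (rule items_simI)
  fix r d i j \<rho> q
  assume mem: "(r, d, i, j, \<rho>) \<in> Scan (pella L D) T k I" and cov: "covers L q r d \<rho>"
  show "(q, d, i, j) \<in> Scan (ella L D) (utok ` T) k I'"
  proof (cases "(r, d, i, j, \<rho>) \<in> I")
    case True
    then show ?thesis
      using items_simD1[OF sim _ cov] ella_extensive(3) by blast
  next
    case False
    then obtain d0 \<rho>0 \<beta> c y where new: "d = Suc d0" "j = k + length c" "\<rho> = \<rho>0 @ [\<beta>, y]"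
      "(r, d0, i, k, \<rho>0) \<in> I" "d0 < rlen r" "(rsyms r ! d0, \<rho>0 ! (2 * d0 + 1), \<beta>, c) \<in> T"
      using mem by (auto simp: pella_def)
    obtain l v where q: "q = (l, v)" by (cases q)
    have prev: "covers L (l, v) r d0 \<rho>0" "d0 < length v"
      "v ! d0 = Sym (rsyms r ! d0) (\<rho>0 ! (2 * d0 + 1)) \<beta>"
      using covers_retreat[OF _ new(5)] wf_items_length[of r d0 i k \<rho>0] new wf cov
      unfolding q by auto
    have I': "((l, v), d0, i, k) \<in> I'" and T': "(v ! d0, c) \<in> utok ` T"
      using items_simD1[OF sim new(4) prev(1)] image_eqI[OF _ new(6), of _ utok] prev(3) by auto
    show ?thesis
      unfolding q new(1,2) by (rule ella_ScanI[OF I' prev(2) T'])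
  qed
next
  fix l v d i j
  assume mem: "((l, v), d, i, j) \<in> Scan (ella L D) (utok ` T) k I'"
    and l: "l \<noteq> Top" and v: "drop d v \<noteq> [Bot]"
  show "\<exists>r \<rho>. (r, d, i, j, \<rho>) \<in> Scan (pella L D) T k I \<and> covers L (l, v) r d \<rho>"
  proof (cases "((l, v), d, i, j) \<in> I'")
    case True
    with sim l v show ?thesis
      by (auto elim!: items_simD2 simp: pella_def)
  next
    case False
    then obtain d0 c where new: "d = Suc d0" "j = k + length c" "((l, v), d0, i, k) \<in> I'"
      "d0 < length v" "(v ! d0, c) \<in> utok ` T"
      using mem by (auto simp: ella_def)
    then obtain t \<alpha> \<beta> where t: "(t, \<alpha>, \<beta>, c) \<in> T" "v ! d0 = Sym t \<alpha> \<beta>" by auto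
    then have "drop d0 v \<noteq> [Bot]"
      using new by (metis Cons_nth_drop_Suc list.inject isym.distinct(6))
    then obtain r \<rho> where 0: "(r, d0, i, k, \<rho>) \<in> I" "covers L (l, v) r d0 \<rho>"
      using items_simD2[OF sim new(3) l] by blast
    obtain y where y: "d0 < rlen r" "rsyms r ! d0 = t" "\<rho> ! (2 * d0 + 1) = \<alpha>"
      "(rfuns r ! Suc d0) (\<rho> @ [\<beta>]) = Some y" "covers L (l, v) r (Suc d0) (\<rho> @ [\<beta>, y])"
      using covers_advance[OF _ 0(2) new(4)] 0(1) wf t v new(1) by fastforce
    then have "(r, Suc d0, i, k + length c, \<rho> @ [\<beta>, y]) \<in> Scan (pella L D) T k I"
      using 0(1) t by (intro pella_ScanI) simp_all
    with y new show ?thesis by blast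
  qed
qed

section \<open>Simulation of limits, token sets and stages\<close>

lemma pi_step_sim:
  assumes sim: "items_sim L I I'" and wf: "I \<subseteq> wf_items L" and good: "I' \<subseteq> good_iitems L"
    and start: "k = 0 \<longrightarrow> start_iitems L \<subseteq> I'"
  shows "items_sim L (pi_step (pella L D) k T I) (pi_step (ella L D) k (utok ` T) I')"
proof -
  let ?P = "pella L D" and ?E = "ella L D"
  define f where "f = Scan ?P T k \<circ> Complete ?P k \<circ> Predict ?P k"
  define g where "g = Scan ?E (utok ` T) k \<circ> Complete ?E k \<circ> Predict ?E k"
  \<comment> \<open>Similarity is carried together with the invariants that the step lemmas consume;
    the start set stays included because the ordinary steps only add items.\<close>
  have step: "items_sim L (f A) (g B) \<and> f A \<subseteq> wf_items L \<and> g B \<subseteq> good_iitems L \<and>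
      (k = 0 \<longrightarrow> start_iitems L \<subseteq> g B)"
    if IH: "items_sim L A B" "A \<subseteq> wf_items L" "B \<subseteq> good_iitems L"
      "k = 0 \<longrightarrow> start_iitems L \<subseteq> B" for A B
  proof (intro conjI)
    note wf' = Predict_wf[OF IH(2), of D k] and good' = Predict_good[OF IH(3), of D k]
    show "items_sim L (f A) (g B)"
      unfolding f_def g_def o_apply
      by (rule Scan_sim[OF Complete_sim[OF Predict_sim[OF IH] wf' good'] Complete_wf[OF wf']])
    show "f A \<subseteq> wf_items L"
      unfolding f_def o_apply by (rule Scan_wf[OF Complete_wf[OF wf']])
    show "g B \<subseteq> good_iitems L"
      unfolding g_def o_apply by (rule Scan_good[OF Complete_good[OF good']])
    have "B \<subseteq> g B"
      unfolding g_def o_apply by (meson ella_extensive subset_trans)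
    then show "k = 0 \<longrightarrow> start_iitems L \<subseteq> g B"
      using IH(4) by (meson subset_trans)
  qed
  have "items_sim L ((f ^^ n) I) ((g ^^ n) I') \<and> (f ^^ n) I \<subseteq> wf_items L \<and>
    (g ^^ n) I' \<subseteq> good_iitems L \<and> (k = 0 \<longrightarrow> start_iitems L \<subseteq> (g ^^ n) I')" for n
  proof (induction n)
    case 0
    with assms show ?case by simp
  next
    case (Suc n)
    then have "items_sim L ((f ^^ n) I) ((g ^^ n) I')" "(f ^^ n) I \<subseteq> wf_items L"
      "(g ^^ n) I' \<subseteq> good_iitems L" "k = 0 \<longrightarrow> start_iitems L \<subseteq> (g ^^ n) I'"
      by simp_all
    then show ?case
      unfolding funpow.simps o_apply by (rule step)
  qed
  then show ?thesis
    unfolding pi_step_def limit_def f_def[symmetric] g_def[symmetric]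
    by (intro items_sim_UN) (rule conjunct1)
qed

lemma Tokens_sim:
  assumes sim: "items_sim L I I'" and wf: "I \<subseteq> wf_items L" and good: "I' \<subseteq> good_iitems L"
    and D: "D \<in> lists (Chars L)" "k \<le> length D"
  shows "Tokens (ella L D) (utok ` T) k I' = utok ` Tokens (pella L D) T k I"
proof -
  let ?B = "{x | x r d i \<rho>. (r, d, i, k, \<rho>) \<in> I \<and> d < rlen r \<and> rsyms r ! d \<in> Terms L \<and>
       x \<in> Lex L (rsyms r ! d) (\<rho> ! (2 * d + 1)) D k}"
  let ?B' = "{x | x l v d i t. ((l, v), d, i, k) \<in> I' \<and> d < length v \<and> v ! d = t \<and>
       t \<in> iterms L \<and> x \<in> ilex L t D k}"
  have "?B' \<subseteq> utok ` ?B"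
  proof
    fix x assume "x \<in> ?B'"
    then obtain l v d i where new: "((l, v), d, i, k) \<in> I'" "d < length v" "v ! d \<in> iterms L"
      "x \<in> ilex L (v ! d) D k"
      by auto
    then obtain t \<alpha> \<beta> c where t: "v ! d = Sym t \<alpha> \<beta>" "t \<in> Terms L"
      "x = (Sym t \<alpha> \<beta>, c)" "(t, \<alpha>, \<beta>, c) \<in> Lex L t \<alpha> D k"
      by (auto simp: iterms_def)
    have "(l, v) \<in> irules L"
      using good new by (auto simp: good_iitems_def)
    \<comment> \<open>A terminal triple follows the dot, whereas a \<open>Top\<close> rule contains
      only the start symbol, a nonterminal. So no candidate token is lost through
      \<open>Norm\<close>.\<close>
    then have "l \<noteq> Top"
      using irules_Top[of v L] new(2) t(1,2) start_nonterm symbols_disjoint by (auto simp: disjoint_iff)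
    moreover have "drop d v \<noteq> [Bot]"
      using new t by (metis Cons_nth_drop_Suc list.inject isym.distinct(6))
    ultimately obtain r \<rho> where 0: "(r, d, i, k, \<rho>) \<in> I" "covers L (l, v) r d \<rho>"
      using items_simD2[OF sim new(1)] by blast
    then have "d < rlen r" "rsyms r ! d = t" "\<rho> ! (2 * d + 1) = \<alpha>"
      using covers_advance[OF _ 0(2) new(2)] wf t by auto
    with 0 t have "(t, \<alpha>, \<beta>, c) \<in> ?B" by blast
    then show "x \<in> utok ` ?B"
      using t(3) by force
  qed
  moreover have "utok ` ?B \<subseteq> ?B'"
  proof (rule image_subsetI)
    fix x assume "x \<in> ?B"
    then obtain r d i \<rho> where x: "(r, d, i, k, \<rho>) \<in> I" "d < rlen r" "rsyms r ! d \<in> Terms L"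
      "x \<in> Lex L (rsyms r ! d) (\<rho> ! (2 * d + 1)) D k"
      by auto
    let ?t = "rsyms r ! d" and ?\<alpha> = "\<rho> ! (2 * d + 1)"
    have \<alpha>: "?\<alpha> \<in> Params L"
      using wf_items_mem[of r d i k \<rho> "2 * d + 1"] x wf by auto
    from lex_tokens[OF x(3) \<alpha> D x(4)] obtain \<beta> c where \<beta>: "x = (?t, ?\<alpha>, \<beta>, c)" "\<beta> \<in> Params L"
      by (auto simp: ptokens_def)
    \<comment> \<open>The token found by \<open>Lex\<close> fixes \<open>\<beta>\<close>; some
      ordinary item has the triple with this \<open>\<beta>\<close> after its dot, and
      \<open>ilex\<close> at that triple returns the same token.\<close>
    obtain l v where v: "covers L (l, v) r d \<rho>" "d < length v" "v ! d = Sym ?t ?\<alpha> \<beta>"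
      using covers_next_ex[OF _ x(2) \<beta>(2)] x(1) wf by blast
    have "((l, v), d, i, k) \<in> I'"
      using items_simD1[OF sim x(1) v(1)] .
    moreover have "v ! d \<in> iterms L"
      using v \<alpha> \<beta> x by (auto simp: iterms_def)
    moreover have "utok x \<in> ilex L (v ! d) D k"
      using v \<beta> x by simp
    ultimately show "utok x \<in> ?B'"
      using v(2) by blast
  qed
  ultimately have eq: "?B' = utok ` ?B" by (rule equalityI)
  show ?thesis
    unfolding pella_def ella_def steps.simps eq isel_utok by (rule refl)
qed

text \<open>Items and tokens share one induction on \<open>u\<close>, since each stage of either is
  computed from the other.\<close>

lemma \<J>_\<T>_sim:
  assumes D: "D \<in> lists (Chars L)" "k \<le> length D"
    and base: "items_sim L (\<J> (pella L D) k 0) (\<J> (ella L D) k 0)"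
  shows "items_sim L (\<J> (pella L D) k u) (\<J> (ella L D) k u) \<and>
    utok ` \<T> (pella L D) k u = \<T> (ella L D) k u"
proof (induction u)
  case 0
  from base show ?case by (simp only: \<T>.simps image_empty simp_thms)
next
  case (Suc u)
  have start: "k = 0 \<longrightarrow> start_iitems L \<subseteq> \<J> (ella L D) k u"
    using start_iitems_subset by blast
  \<comment> \<open>Tokens come first: they depend only on stage \<open>u\<close>, while the items
    of stage \<open>Suc u\<close> depend on the tokens of stage \<open>Suc u\<close>.\<close>
  have tok: "\<T> (ella L D) k (Suc u) = utok ` \<T> (pella L D) k (Suc u)"
    using Tokens_sim[OF conjunct1[OF Suc] \<J>_wf \<J>_good D, of "\<T> (pella L D) k u"]
    unfolding \<T>.simps conjunct2[OF Suc] .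
  have "items_sim L (\<J> (pella L D) k (Suc u)) (\<J> (ella L D) k (Suc u))"
    unfolding \<J>_Suc_right tok
    by (rule pi_step_sim[OF conjunct1[OF Suc] \<J>_wf \<J>_good start])
  then show ?case
    by (rule conjI) (rule tok[symmetric])
qed

end

theorem theorem16:
  fixes L :: "('s, 'p, 'c) pll" and D :: "'c list" and k :: nat
  assumes "parameterized_local_lexing L"
    and "D \<in> lists (Chars L)"
    and "k \<le> length D"
    and "items_sim L (\<J> (pella L D) k 0) (\<J> (ella L D) k 0)"
  shows "(\<forall>u. items_sim L (\<J> (pella L D) k u) (\<J> (ella L D) k u)) \<and>
    (\<forall>u. utok ` \<T> (pella L D) k u = \<T> (ella L D) k u) \<and>
    items_sim L (\<I> (pella L D) k) (\<I> (ella L D) k)"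
proof -
  interpret parameterized_local_lexing L by fact
  note sim = \<J>_\<T>_sim[OF assms(2-4)]
  have "items_sim L (\<I> (pella L D) k) (\<I> (ella L D) k)"
    unfolding \<I>_def by (rule items_sim_UN) (rule conjunct1[OF sim])
  with sim show ?thesis by blast
qed

end
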